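(* Let $\Omega\subset\mathbb{R}^N$, $N\ge1$, be a bounded smooth domain and $s\in(0,1)$. Let $g:\overline\Omega\times\mathbb{R}\to\mathbb{R}$, set $G(x,t):=\int_0^t g(x,\tau)\,d\tau$, and assume that (G) for every $x\in\Omega$, the function $t\mapsto G(x,\sqrt t)$ is strictly concave in $[0,\infty)$; (g) $g$ is continuous, of the form $g=g_1+g_2$, with $g_1(x,0)=0$, $t\mapsto g_1(x,t)$ locally Lipschitz continuous in $\mathbb{R}$ uniformly in $x$, and $g_2$ continuous and nonnegative in $\overline\Omega\times[0,\infty)$. Let $X=\mathcal H^s_0(\Omega)$ or $X=\mathcal H^s_0(\Omega)\cap L^p(\Omega)$ for some $p>2$ be such that $$I(u):=\frac14\int_{\mathbb{R}^N}\int_{\mathbb{R}^N}\frac{|u(x)-u(y)|^2}{|x-y|^{N+2s}}\,dx\,dy-\int_\Omega G(x,u(x))\,dx,\qquad u\in X,$$ is Fréchet differentiable in $X$ and the derivative of $u\mapsto\int_\Omega G(x,u)\,dx$ evaluated at $v\in X$ is $\int_\Omega g(x,u)v\,dx$. Then the problem $$(-\Delta)^su=g(x,u)\ \text{ in }\Omega,\qquad u\equiv0\ \text{ in }\mathbb{R}^N\setminus\Omega$$ has at most one positive weak solution $u\in C^{0,s}(\overline\Omega)\cap\mathcal H^s_0(\Omega)$.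
   Context: $\mathcal H^s_0(\Omega)$ is the space of all $u\in L^2(\mathbb{R}^N)$ with $u\equiv0$ in $\mathbb{R}^N\setminus\Omega$ and $\|u\|_{H^s}:=\left(\int_{\mathbb{R}^N}\int_{\mathbb{R}^N}\frac{|u(x)-u(y)|^2}{|x-y|^{N+2s}}\,dx\,dy\right)^{1/2}<\infty$. The space $\mathcal H^s_0(\Omega)\cap L^p(\Omega)$ carries the norm $\|u\|_X=\|u\|_{H^s}+\|u\|_{L^p(\Omega)}$. The fractional Laplacian is $(-\Delta)^su(x)=\lim_{\varepsilon\to0}\int_{|x-y|\ge\varepsilon}\frac{u(x)-u(y)}{|x-y|^{N+2s}}\,dy$ (no normalization constant). A function $u\in C^{0,s}(\overline\Omega)\cap\mathcal H^s_0(\Omega)$ is a weak solution if $\frac12\int_{\mathbb{R}^N}\int_{\mathbb{R}^N}\frac{(u(x)-u(y))(\phi(x)-\phi(y))}{|x-y|^{N+2s}}\,dx\,dy=\int_\Omega g(x,u(x))\phi(x)\,dx$ for all $\phi\in\mathcal H^s_0(\Omega)$. Positive means $u>0$ in $\Omega$. *)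

theory Defs
  imports "HOL-Analysis.Analysis"
begin

text \<open>Meant for open \<open>S\<close>, where differentiability within \<open>S\<close> and at a point agree.\<close>

fun C_k_on :: "nat \<Rightarrow> 'a::euclidean_space set \<Rightarrow> ('a \<Rightarrow> real) \<Rightarrow> bool" where
  "C_k_on 0 S f \<longleftrightarrow> continuous_on S f"
| "C_k_on (Suc k) S f \<longleftrightarrow>
     f differentiable_on S \<and>
     (\<forall>i\<in>Basis. C_k_on k S (\<lambda>x. frechet_derivative f (at x) i))"

definition smooth_on :: "'a::euclidean_space set \<Rightarrow> ('a \<Rightarrow> real) \<Rightarrow> bool" where
  "smooth_on S f \<longleftrightarrow> (\<forall>k. C_k_on k S f)"

text \<open>The boundary is locally the graph of a smooth function over a hyperplane, with the domain
  on one side of it.  The unit vector \<open>e\<close> is the graph direction; \<open>x - (x \<bullet> e) *\<^sub>R e\<close> is the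
  projection of \<open>x\<close> to the hyperplane orthogonal to \<open>e\<close>, so only the values of \<open>\<gamma>\<close> on that
  hyperplane matter.\<close>

definition smooth_boundary :: "'a::euclidean_space set \<Rightarrow> bool" where
  "smooth_boundary \<Omega> \<longleftrightarrow>
     (\<forall>x0\<in>frontier \<Omega>. \<exists>r>0. \<exists>e \<gamma>. norm e = 1 \<and> smooth_on UNIV \<gamma> \<and>
        \<Omega> \<inter> ball x0 r = {x \<in> ball x0 r. x \<bullet> e > \<gamma> (x - (x \<bullet> e) *\<^sub>R e)})"

definition bounded_smooth_domain :: "'a::euclidean_space set \<Rightarrow> bool" where
  "bounded_smooth_domain \<Omega> \<longleftrightarrow>
     open \<Omega> \<and> connected \<Omega> \<and> \<Omega> \<noteq> {} \<and> bounded \<Omega> \<and> smooth_boundary \<Omega>"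

definition strictly_concave_on :: "'a::real_vector set \<Rightarrow> ('a \<Rightarrow> real) \<Rightarrow> bool" where
  "strictly_concave_on S f \<longleftrightarrow> convex S \<and>
     (\<forall>x\<in>S. \<forall>y\<in>S. \<forall>t. x \<noteq> y \<longrightarrow> 0 < t \<longrightarrow> t < 1 \<longrightarrow>
        f ((1 - t) *\<^sub>R x + t *\<^sub>R y) > (1 - t) * f x + t * f y)"

definition holder_on :: "real \<Rightarrow> 'a::metric_space set \<Rightarrow> ('a \<Rightarrow> real) \<Rightarrow> bool" where
  "holder_on \<alpha> S f \<longleftrightarrow>
     (\<exists>C. \<forall>x\<in>S. \<forall>y\<in>S. \<bar>f x - f y\<bar> \<le> C * dist x y powr \<alpha>)"

text \<open>On the diagonal the integrand below is \<open>0 / 0 = 0\<close>, which is harmless as the diagonal is a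
  null set.\<close>

definition gagliardo_kernel ::
  "real \<Rightarrow> (real^'n \<Rightarrow> real) \<Rightarrow> (real^'n \<Rightarrow> real) \<Rightarrow> (real^'n) \<times> (real^'n) \<Rightarrow> real" where
  "gagliardo_kernel s u v = (\<lambda>(x, y).
     (u x - u y) * (v x - v y) / norm (x - y) powr (real CARD('n) + 2 * s))"

definition gagliardo_form :: "real \<Rightarrow> (real^'n \<Rightarrow> real) \<Rightarrow> (real^'n \<Rightarrow> real) \<Rightarrow> real" where
  "gagliardo_form s u v = (LINT z|(lborel \<Otimes>\<^sub>M lborel). gagliardo_kernel s u v z)"

text \<open>Elements of the function spaces are represented by functions, not by classes modulo null
  sets.  Every class has a Borel representative vanishing at every point outside \<open>\<Omega>\<close>, and the
  norms and integrals below do not depend on the representative.\<close>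

definition Hs0 :: "real \<Rightarrow> (real^'n) set \<Rightarrow> (real^'n \<Rightarrow> real) set" where
  "Hs0 s \<Omega> = {u. u \<in> borel_measurable borel \<and> integrable lborel (\<lambda>x. (u x)\<^sup>2) \<and>
     (\<forall>x. x \<notin> \<Omega> \<longrightarrow> u x = 0) \<and>
     integrable (lborel \<Otimes>\<^sub>M lborel) (gagliardo_kernel s u u)}"

definition norm_Hs :: "real \<Rightarrow> (real^'n \<Rightarrow> real) \<Rightarrow> real" where
  "norm_Hs s u = sqrt (gagliardo_form s u u)"

definition Lp :: "real \<Rightarrow> (real^'n) set \<Rightarrow> (real^'n \<Rightarrow> real) set" where
  "Lp p \<Omega> = {u. set_borel_measurable lborel \<Omega> u \<and>
     set_integrable lborel \<Omega> (\<lambda>x. \<bar>u x\<bar> powr p)}"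

definition norm_Lp :: "real \<Rightarrow> (real^'n) set \<Rightarrow> (real^'n \<Rightarrow> real) \<Rightarrow> real" where
  "norm_Lp p \<Omega> u = (LINT x:\<Omega>|lborel. \<bar>u x\<bar> powr p) powr (1 / p)"

text \<open>Frechet derivative at \<open>u\<close> of a functional on a linear space \<open>X\<close> of functions with norm \<open>nX\<close>.
  The library's derivative lives on whole normed types and does not apply.\<close>

definition has_frechet_derivative_in ::
  "(('a \<Rightarrow> real) \<Rightarrow> real) \<Rightarrow> (('a \<Rightarrow> real) \<Rightarrow> real) \<Rightarrow> ('a \<Rightarrow> real) set \<Rightarrow>
   (('a \<Rightarrow> real) \<Rightarrow> real) \<Rightarrow> ('a \<Rightarrow> real) \<Rightarrow> bool" where
  "has_frechet_derivative_in J L X nX u \<longleftrightarrow>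
     (\<forall>v\<in>X. \<forall>w\<in>X. L (\<lambda>x. v x + w x) = L v + L w) \<and>
     (\<forall>c. \<forall>v\<in>X. L (\<lambda>x. c * v x) = c * L v) \<and>
     (\<exists>C. \<forall>v\<in>X. \<bar>L v\<bar> \<le> C * nX v) \<and>
     (\<forall>\<epsilon>>0. \<exists>\<delta>>0. \<forall>h\<in>X. nX h < \<delta> \<longrightarrow>
        \<bar>J (\<lambda>x. u x + h x) - J u - L h\<bar> \<le> \<epsilon> * nX h)"

definition primitive :: "('a \<Rightarrow> real \<Rightarrow> real) \<Rightarrow> 'a \<Rightarrow> real \<Rightarrow> real" where
  "primitive g x t = (LBINT \<tau>=ereal 0..ereal t. g x \<tau>)"

definition potential ::
  "(real^'n) set \<Rightarrow> (real^'n \<Rightarrow> real \<Rightarrow> real) \<Rightarrow> (real^'n \<Rightarrow> real) \<Rightarrow> real" where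
  "potential \<Omega> g u = (LINT x:\<Omega>|lborel. primitive g x (u x))"

definition energy ::
  "real \<Rightarrow> (real^'n) set \<Rightarrow> (real^'n \<Rightarrow> real \<Rightarrow> real) \<Rightarrow> (real^'n \<Rightarrow> real) \<Rightarrow> real" where
  "energy s \<Omega> g u = 1 / 4 * gagliardo_form s u u - potential \<Omega> g u"

definition weak_solution ::
  "real \<Rightarrow> (real^'n) set \<Rightarrow> (real^'n \<Rightarrow> real \<Rightarrow> real) \<Rightarrow> (real^'n \<Rightarrow> real) \<Rightarrow> bool" where
  "weak_solution s \<Omega> g u \<longleftrightarrow>
     u \<in> Hs0 s \<Omega> \<and> holder_on s (closure \<Omega>) u \<and>
     (\<forall>\<phi>\<in>Hs0 s \<Omega>. 1 / 2 * gagliardo_form s u \<phi> = (LINT x:\<Omega>|lborel. g x (u x) * \<phi> x))"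

end

theory Submission
  imports Defs
begin

text \<open>Brezis--Oswald argument with regularized test functions.  Given positive solutions \<open>u\<close>, \<open>v\<close>, put
  \<open>U = u + \<epsilon>\<close>, \<open>V = v + \<epsilon>\<close> and test the equation of \<open>u\<close> with \<open>U - V\<^sup>2 / U\<close> and that of \<open>v\<close> with
  \<open>V - U\<^sup>2 / V\<close>; both lie in the energy space because \<open>U, V \<ge> \<epsilon>\<close>.  By the pointwise Picone
  inequality the two quadratic forms have a nonnegative sum, so
  \<open>0 \<le> \<integral> (g(x,u) / U - g(x,v) / V) (U\<^sup>2 - V\<^sup>2)\<close>.  Condition (g) bounds the integrand from above
  uniformly in \<open>\<epsilon>\<close>, and as \<open>\<epsilon> \<rightarrow> 0\<close> it tends to \<open>(g(x,u) / u - g(x,v) / v) (u\<^sup>2 - v\<^sup>2)\<close>.  Condition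
  (G) says that \<open>t \<mapsto> g(x,t) / t\<close> is strictly decreasing, so this limit is negative wherever
  \<open>u \<noteq> v\<close>.  No Hopf lemma is needed to compare \<open>u\<close> with \<open>v\<close> near the boundary.\<close>

section \<open>Strict concavity and the quotient \<open>g x t / t\<close>\<close>

lemma strictly_concave_on_imp_concave_on:
  assumes "strictly_concave_on S f"
  shows "concave_on S f"
  unfolding concave_on_def convex_on_def
proof (intro conjI ballI allI impI)
  show "convex S"
    using assms by (simp add: strictly_concave_on_def)
next
  fix x y and a b :: real
  assume xy: "x \<in> S" "y \<in> S" and ab: "0 \<le> a" "0 \<le> b" "a + b = 1"
  have a: "a = 1 - b" using ab by simp
  show "- f (a *\<^sub>R x + b *\<^sub>R y) \<le> a * - f x + b * - f y"
  proof (cases "x = y \<or> b = 0 \<or> b = 1")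
    case True
    moreover have "(1 - b) *\<^sub>R y + b *\<^sub>R y = y"
      by (simp flip: scaleR_add_left)
    ultimately show ?thesis
      by (auto simp: a algebra_simps)
  next
    case False
    then have "x \<noteq> y" "0 < b" "b < 1"
      using ab by auto
    then have "(1 - b) * f x + b * f y < f ((1 - b) *\<^sub>R x + b *\<^sub>R y)"
      using assms xy by (simp add: strictly_concave_on_def)
    then show ?thesis
      by (simp add: a)
  qed
qed

text \<open>Both tangent lines lie above \<open>f\<close>. Added at the midpoint \<open>m\<close>,
  they give \<open>f a + f b + (a' - b') * (b - a) / 2 \<ge> 2 * f m\<close>, while strict concavity
  gives \<open>2 * f m > f a + f b\<close>.\<close>

lemma strictly_concave_on_deriv_less:
  fixes f :: "real \<Rightarrow> real"
  assumes f: "strictly_concave_on S f" and ab: "a < b"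
    and int: "a \<in> interior S" "b \<in> interior S"
    and a: "(f has_real_derivative a') (at a)" and b: "(f has_real_derivative b') (at b)"
  shows "b' < a'"
proof -
  have S: "a \<in> S" "b \<in> S" and conv: "convex S" "connected S"
    using int interior_subset f
    by (auto simp: strictly_concave_on_def intro: convex_connected)
  have cv: "convex_on S (\<lambda>x. - f x)"
    using strictly_concave_on_imp_concave_on[OF f] by (simp add: concave_on_def)
  define m where "m = (1 - 1/2) *\<^sub>R a + (1/2) *\<^sub>R b"
  have m: "m \<in> S"
    using conv(1) S unfolding m_def by (intro convexD_alt) auto
  have "- f m - - f a \<ge> - a' * (m - a)"
    using convex_on_imp_above_tangent[OF cv conv(2) int(1) m, of "- a'"] a
    by (simp add: DERIV_minus has_field_derivative_at_within)
  moreover have "- f m - - f b \<ge> - b' * (m - b)"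
    using convex_on_imp_above_tangent[OF cv conv(2) int(2) m, of "- b'"] b
    by (simp add: DERIV_minus has_field_derivative_at_within)
  moreover have "f m > (1 - 1/2) * f a + (1/2) * f b"
    using f S ab unfolding m_def strictly_concave_on_def
    by (elim conjE) (drule bspec[of _ _ a], simp, drule bspec[of _ _ b], simp,
        drule spec[of _ "1/2"], simp)
  moreover have "m - a = (b - a) / 2" "m - b = - ((b - a) / 2)"
    by (simp_all add: m_def field_simps)
  ultimately have "b' * ((b - a) / 2) < a' * ((b - a) / 2)"
    by simp
  then show ?thesis
    using ab by simp
qed

lemma primitive_has_derivative:
  assumes "continuous_on UNIV (g x)"
  shows "(primitive g x has_real_derivative g x t) (at t)"
proof -
  \<comment> \<open>This choice puts both the base point \<open>0\<close> and \<open>t\<close>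
    inside \<open>{-c..c}\<close>, with \<open>t\<close> in the interior, whatever the sign of
    \<open>t\<close>.\<close>
  define c where "c = \<bar>t\<bar> + 1"
  have "((\<lambda>u. LBINT y=ereal 0..ereal u. g x y) has_vector_derivative g x t) (at t within {-c..c})"
    by (rule interval_integral_FTC2) (auto simp: c_def intro: continuous_on_subset[OF assms])
  moreover have "at t within {-c..c} = at t"
    by (rule at_within_interior) (auto simp: c_def interior_atLeastAtMost_real)
  ultimately show ?thesis
    by (simp add: has_real_derivative_iff_has_vector_derivative primitive_def[abs_def])
qed

text \<open>The derivative of \<open>\<lambda>t. primitive g x (sqrt t)\<close> at
  \<open>r\<^sup>2\<close> is \<open>g x r / (2 * r)\<close>, and strict concavity makes it strictly
  decreasing.\<close>

lemma quotient_strict_antimono: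
  assumes conc: "strictly_concave_on {0..} (\<lambda>t. primitive g x (sqrt t))"
    and cont: "continuous_on UNIV (g x)" and t: "0 < t1" "t1 < t2"
  shows "g x t2 / t2 < g x t1 / t1"
proof -
  have der: "((\<lambda>t. primitive g x (sqrt t)) has_real_derivative g x r / (2 * r)) (at (r\<^sup>2))"
    if "r > 0" for r
  proof -
    have "(sqrt has_real_derivative inverse (sqrt (r\<^sup>2)) / 2) (at (r\<^sup>2))"
      using that by (intro DERIV_real_sqrt) simp
    from DERIV_chain2[OF primitive_has_derivative[of g x, OF cont] this] that
    show ?thesis by (simp add: field_simps)
  qed
  have "g x t2 / (2 * t2) < g x t1 / (2 * t1)"
  proof (rule strictly_concave_on_deriv_less[OF conc _ _ _ der der])
    show "t1\<^sup>2 < t2\<^sup>2" using t by (simp add: power_strict_mono)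
  qed (use t in \<open>auto simp: interior_real_atLeast\<close>)
  then have "g x t2 / t2 / 2 < g x t1 / t1 / 2"
    by (simp add: mult.commute)
  then show ?thesis
    by simp
qed

section \<open>Algebra behind the Picone inequality\<close>

text \<open>With \<open>c = p * a\<close> and \<open>d = q * b\<close> the right side exceeds the
  left by exactly \<open>a * b * (p - q)\<^sup>2\<close>.\<close>

lemma discrete_picone:
  fixes a b c d :: real
  assumes "0 < a" "0 < b"
  shows "(a - b) * (c\<^sup>2 / a - d\<^sup>2 / b) \<le> (c - d)\<^sup>2"
proof -
  define p q where "p = c / a" and "q = d / b"
  have c: "c = p * a" and d: "d = q * b"
    using assms by (auto simp: p_def q_def)
  have *: "c\<^sup>2 / a = p\<^sup>2 * a" "d\<^sup>2 / b = q\<^sup>2 * b"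
    using assms by (simp_all add: c d power2_eq_square)
  have "(c - d)\<^sup>2 - (a - b) * (c\<^sup>2 / a - d\<^sup>2 / b) = a * b * (p - q)\<^sup>2"
    unfolding * unfolding c d by algebra
  also have "\<dots> \<ge> 0"
    using assms by simp
  finally show ?thesis
    by simp
qed

text \<open>Numerator and denominator are changed one at a time. The lower bound \<open>e\<close> on
  the denominators keeps both coefficients finite.\<close>

lemma square_quotient_lipschitz:
  fixes a b c d e R :: real
  assumes e: "0 < e" and a: "e \<le> a" and b: "e \<le> b" and c: "0 \<le> c" "c \<le> R" and d: "0 \<le> d" "d \<le> R"
  shows "\<bar>c\<^sup>2 / a - d\<^sup>2 / b\<bar> \<le> 2 * R / e * \<bar>c - d\<bar> + R\<^sup>2 / e\<^sup>2 * \<bar>a - b\<bar>"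
proof -
  have pos: "a > 0" "b > 0" using assms by auto
  have "c\<^sup>2 / a - d\<^sup>2 / b = (c + d) / a * (c - d) - d\<^sup>2 / (a * b) * (a - b)"
  proof -
    have "(c + d) / a * (c - d) = c\<^sup>2 / a - d\<^sup>2 / a"
      by (simp add: algebra_simps power2_eq_square flip: diff_divide_distrib)
    moreover have "d\<^sup>2 / (a * b) * (a - b) = d\<^sup>2 / b - d\<^sup>2 / a"
      using pos by (simp add: right_diff_distrib)
    ultimately show ?thesis
      by simp
  qed
  also have "\<bar>\<dots>\<bar> \<le> (c + d) / a * \<bar>c - d\<bar> + d\<^sup>2 / (a * b) * \<bar>a - b\<bar>"
    using pos c d by (intro order_trans[OF abs_triangle_ineq4]) (simp add: abs_mult)
  also have "\<dots> \<le> 2 * R / e * \<bar>c - d\<bar> + R\<^sup>2 / e\<^sup>2 * \<bar>a - b\<bar>"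
  proof (intro add_mono mult_right_mono frac_le)
    show "e\<^sup>2 \<le> a * b"
      using e a b by (simp add: power2_eq_square mult_mono)
  qed (use assms in \<open>auto intro: power_mono\<close>)
  finally show ?thesis .
qed

section \<open>The Gagliardo form and membership in the energy space\<close>

lemma gagliardo_kernel_measurable:
  assumes [measurable]: "u \<in> borel_measurable borel" "v \<in> borel_measurable borel"
  shows "gagliardo_kernel s u v \<in> borel_measurable (lborel \<Otimes>\<^sub>M lborel)"
  unfolding gagliardo_kernel_def by measurable

lemma gagliardo_kernel_integrable:
  assumes u: "u \<in> Hs0 s \<Omega>" and v: "v \<in> Hs0 s \<Omega>"
  shows "integrable (lborel \<Otimes>\<^sub>M lborel) (gagliardo_kernel s u v)"
proof (rule Bochner_Integration.integrable_bound)
  show "integrable (lborel \<Otimes>\<^sub>M lborel)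
      (\<lambda>z. gagliardo_kernel s u u z + gagliardo_kernel s v v z)"
    using assms by (simp add: Hs0_def)
  show "gagliardo_kernel s u v \<in> borel_measurable (lborel \<Otimes>\<^sub>M lborel)"
    using assms by (intro gagliardo_kernel_measurable) (auto simp: Hs0_def)
  have *: "\<bar>a * b\<bar> \<le> a * a + b * b" for a b :: real
  proof -
    have "2 * (\<bar>a\<bar> * \<bar>b\<bar>) \<le> a\<^sup>2 + b\<^sup>2"
      using sum_squares_bound[of "\<bar>a\<bar>" "\<bar>b\<bar>"] by (simp add: mult.assoc)
    moreover have "0 \<le> \<bar>a\<bar> * \<bar>b\<bar>" by simp
    ultimately show ?thesis
      unfolding abs_mult power2_eq_square by linarith
  qed
  show "AE z in lborel \<Otimes>\<^sub>M lborel. norm (gagliardo_kernel s u v z)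
      \<le> norm (gagliardo_kernel s u u z + gagliardo_kernel s v v z)"
    by (auto simp: gagliardo_kernel_def * simp flip: add_divide_distrib
        intro!: AE_I2 divide_right_mono)
qed

text \<open>Brings nonlinear expressions in \<open>u\<close> and \<open>v\<close> into the energy
  space: by \<open>(p + q)\<^sup>2 \<le> 2 * p\<^sup>2 + 2 * q\<^sup>2\<close> the kernel of
  \<open>\<phi>\<close> is dominated by those of \<open>u\<close> and \<open>v\<close>, and square
  integrability comes from boundedness of \<open>\<phi>\<close> and \<open>\<Omega>\<close>.\<close>

lemma Hs0_lipschitz_combination:
  assumes u: "u \<in> Hs0 s \<Omega>" and v: "v \<in> Hs0 s \<Omega>" and "bounded \<Omega>"
    and [measurable]: "\<phi> \<in> borel_measurable borel"
    and zero: "\<And>x. x \<notin> \<Omega> \<Longrightarrow> \<phi> x = 0" and M: "\<And>x. \<bar>\<phi> x\<bar> \<le> M"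
    and K: "\<And>x y. \<bar>\<phi> x - \<phi> y\<bar> \<le> K1 * \<bar>u x - u y\<bar> + K2 * \<bar>v x - v y\<bar>"
  shows "\<phi> \<in> Hs0 s \<Omega>"
proof -
  \<comment> \<open>The closure is Borel, whereas \<open>\<Omega>\<close> is only assumed bounded
    here.\<close>
  have fin: "emeasure lborel (closure \<Omega>) < \<infinity>"
    using \<open>bounded \<Omega>\<close> by (intro emeasure_bounded_finite bounded_closure)
  have "integrable lborel (\<lambda>x. (\<phi> x)\<^sup>2)"
  proof (rule Bochner_Integration.integrable_bound)
    show "integrable lborel (\<lambda>x. indicator (closure \<Omega>) x * M\<^sup>2)"
      using fin by (intro integrable_mult_left) simp
    have "(\<phi> x)\<^sup>2 \<le> M\<^sup>2" for x
      using M[of x] by (rule power2_le_iff_abs_le[THEN iffD2, rotated]) (use M[of x] in linarith)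
    then show "AE x in lborel. norm ((\<phi> x)\<^sup>2) \<le> norm (indicator (closure \<Omega>) x * M\<^sup>2)"
      using zero closure_subset[of \<Omega>] by (intro AE_I2) (auto simp: indicator_def)
  qed simp
  moreover have "integrable (lborel \<Otimes>\<^sub>M lborel) (gagliardo_kernel s \<phi> \<phi>)"
  proof (rule Bochner_Integration.integrable_bound)
    show "integrable (lborel \<Otimes>\<^sub>M lborel)
        (\<lambda>z. 2 * K1\<^sup>2 * gagliardo_kernel s u u z + 2 * K2\<^sup>2 * gagliardo_kernel s v v z)"
      using u v by (simp add: Hs0_def)
    show "gagliardo_kernel s \<phi> \<phi> \<in> borel_measurable (lborel \<Otimes>\<^sub>M lborel)"
      by (rule gagliardo_kernel_measurable) simp_all
    have *: "(\<phi> x - \<phi> y) * (\<phi> x - \<phi> y)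
        \<le> 2 * K1\<^sup>2 * ((u x - u y) * (u x - u y)) + 2 * K2\<^sup>2 * ((v x - v y) * (v x - v y))" for x y
    proof -
      have "(\<phi> x - \<phi> y)\<^sup>2 \<le> (K1 * \<bar>u x - u y\<bar> + K2 * \<bar>v x - v y\<bar>)\<^sup>2"
        using K[of x y] by (metis abs_ge_zero order.trans power2_abs power_mono)
      also have "\<dots> \<le> 2 * (K1 * \<bar>u x - u y\<bar>)\<^sup>2 + 2 * (K2 * \<bar>v x - v y\<bar>)\<^sup>2"
        using zero_le_power2[of "K1 * \<bar>u x - u y\<bar> - K2 * \<bar>v x - v y\<bar>"]
        unfolding power2_sum power2_diff by linarith
      finally show ?thesis
        by (simp only: power_mult_distrib power2_abs) (simp only: power2_eq_square mult_ac)
    qed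
    have "norm (gagliardo_kernel s \<phi> \<phi> (x, y))
        \<le> 2 * K1\<^sup>2 * gagliardo_kernel s u u (x, y) + 2 * K2\<^sup>2 * gagliardo_kernel s v v (x, y)"
      for x y
      using divide_right_mono[OF *[of x y], of "norm (x - y) powr (real CARD('a) + 2 * s)"]
      by (simp add: gagliardo_kernel_def add_divide_distrib)
    then show "AE z in lborel \<Otimes>\<^sub>M lborel. norm (gagliardo_kernel s \<phi> \<phi> z)
      \<le> norm (2 * K1\<^sup>2 * gagliardo_kernel s u u z + 2 * K2\<^sup>2 * gagliardo_kernel s v v z)"
      by (intro AE_I2) (auto intro: order_trans[OF _ abs_ge_self])
  qed
  ultimately show ?thesis
    using zero by (simp add: Hs0_def)
qed

lemma holder_on_imp_continuous_on:
  assumes "holder_on \<alpha> S f" "0 < \<alpha>"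
  shows "continuous_on S f"
proof -
  obtain C where C: "\<And>x y. x \<in> S \<Longrightarrow> y \<in> S \<Longrightarrow> \<bar>f x - f y\<bar> \<le> C * dist x y powr \<alpha>"
    using assms by (auto simp: holder_on_def)
  show ?thesis
    unfolding continuous_on_def
  proof
    fix x assume x: "x \<in> S"
    have "((\<lambda>y. C * dist y x powr \<alpha>) \<longlongrightarrow> 0) (at x within S)"
      using assms(2) by (auto intro!: tendsto_eq_intros simp: eventually_at_filter)
    then have "((\<lambda>y. f y - f x) \<longlongrightarrow> 0) (at x within S)"
      by (rule Lim_null_comparison[rotated])
        (use C x in \<open>auto simp: eventually_at_filter intro!: always_eventually\<close>)
    then show "(f \<longlongrightarrow> f x) (at x within S)"
      by (simp add: Lim_null[symmetric])
  qed
qed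

text \<open>Shifting both functions by the same \<open>\<epsilon>\<close> makes the value
  \<open>\<epsilon> - \<epsilon>\<^sup>2 / \<epsilon> = 0\<close> wherever both vanish, hence
  outside \<open>\<Omega>\<close>.\<close>

definition picone_test :: "real \<Rightarrow> ('a \<Rightarrow> real) \<Rightarrow> ('a \<Rightarrow> real) \<Rightarrow> 'a \<Rightarrow> real" where
  "picone_test \<epsilon> u v x = (u x + \<epsilon>) - (v x + \<epsilon>)\<^sup>2 / (u x + \<epsilon>)"

lemma picone_test_in_Hs0:
  assumes u: "u \<in> Hs0 s \<Omega>" and v: "v \<in> Hs0 s \<Omega>" and \<Omega>: "bounded \<Omega>" and e: "0 < \<epsilon>"
    and uM: "\<And>x. 0 \<le> u x \<and> u x \<le> M" and vM: "\<And>x. 0 \<le> v x \<and> v x \<le> M"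
  shows "picone_test \<epsilon> u v \<in> Hs0 s \<Omega>"
proof (rule Hs0_lipschitz_combination[OF u v \<Omega>])
  have [measurable]: "u \<in> borel_measurable borel" "v \<in> borel_measurable borel"
    and zero: "\<And>x. x \<notin> \<Omega> \<Longrightarrow> u x = 0" "\<And>x. x \<notin> \<Omega> \<Longrightarrow> v x = 0"
    using u v by (auto simp: Hs0_def)
  show "picone_test \<epsilon> u v \<in> borel_measurable borel"
    unfolding picone_test_def[abs_def] by measurable
  show "picone_test \<epsilon> u v x = 0" if "x \<notin> \<Omega>" for x
    using that e by (simp add: picone_test_def zero power2_eq_square)
  let ?R = "M + \<epsilon>"
  show "\<bar>picone_test \<epsilon> u v x\<bar> \<le> ?R + ?R\<^sup>2 / \<epsilon>" for x
  proof -
    have "(v x + \<epsilon>)\<^sup>2 / (u x + \<epsilon>) \<le> ?R\<^sup>2 / \<epsilon>"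
      using uM[of x] vM[of x] e by (intro frac_le power_mono) auto
    moreover have "0 \<le> (v x + \<epsilon>)\<^sup>2 / (u x + \<epsilon>)"
      using uM[of x] e by simp
    ultimately show ?thesis
      using uM[of x] e unfolding picone_test_def by linarith
  qed
  show "\<bar>picone_test \<epsilon> u v x - picone_test \<epsilon> u v y\<bar>
      \<le> (1 + ?R\<^sup>2 / \<epsilon>\<^sup>2) * \<bar>u x - u y\<bar> + 2 * ?R / \<epsilon> * \<bar>v x - v y\<bar>" for x y
  proof -
    have "\<bar>(v x + \<epsilon>)\<^sup>2 / (u x + \<epsilon>) - (v y + \<epsilon>)\<^sup>2 / (u y + \<epsilon>)\<bar>
        \<le> 2 * ?R / \<epsilon> * \<bar>(v x + \<epsilon>) - (v y + \<epsilon>)\<bar> + ?R\<^sup>2 / \<epsilon>\<^sup>2 * \<bar>(u x + \<epsilon>) - (u y + \<epsilon>)\<bar>"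
      using uM[of x] vM[of x] uM[of y] vM[of y] e
      by (intro square_quotient_lipschitz) auto
    then show ?thesis
      unfolding picone_test_def by (simp add: algebra_simps)
  qed
qed

text \<open>By the discrete Picone inequality the first integrand has numerator at least
  \<open>(u x - u y)\<^sup>2 - (v x - v y)\<^sup>2\<close>, and the second at least the negative of
  this, so the sum is nonnegative pointwise.\<close>

lemma gagliardo_form_picone_nonneg:
  assumes u: "u \<in> Hs0 s \<Omega>" and v: "v \<in> Hs0 s \<Omega>" and \<Omega>: "bounded \<Omega>" and e: "0 < \<epsilon>"
    and uM: "\<And>x. 0 \<le> u x \<and> u x \<le> M" and vM: "\<And>x. 0 \<le> v x \<and> v x \<le> M"
  shows "0 \<le> gagliardo_form s u (picone_test \<epsilon> u v) + gagliardo_form s v (picone_test \<epsilon> v u)"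
proof -
  have *: "0 \<le> (u x - u y) * (picone_test \<epsilon> u v x - picone_test \<epsilon> u v y)
      + (v x - v y) * (picone_test \<epsilon> v u x - picone_test \<epsilon> v u y)" for x y
    using discrete_picone[of "u x + \<epsilon>" "u y + \<epsilon>" "v x + \<epsilon>" "v y + \<epsilon>"]
      discrete_picone[of "v x + \<epsilon>" "v y + \<epsilon>" "u x + \<epsilon>" "u y + \<epsilon>"]
      uM[of x] uM[of y] vM[of x] vM[of y] e
    by (simp add: picone_test_def power2_eq_square algebra_simps)
  have "0 \<le> (LINT z|(lborel \<Otimes>\<^sub>M lborel).
      gagliardo_kernel s u (picone_test \<epsilon> u v) z + gagliardo_kernel s v (picone_test \<epsilon> v u) z)"
    by (rule Bochner_Integration.integral_nonneg)
      (auto simp: gagliardo_kernel_def * simp flip: add_divide_distrib)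
  also have "\<dots> = gagliardo_form s u (picone_test \<epsilon> u v) + gagliardo_form s v (picone_test \<epsilon> v u)"
    unfolding gagliardo_form_def
    using assms
    by (intro Bochner_Integration.integral_add gagliardo_kernel_integrable picone_test_in_Hs0) auto
  finally show ?thesis .
qed

section \<open>Almost-everywhere vanishing and passage to the limit\<close>

text \<open>The set \<open>?W\<close> where \<open>f\<close> is nonzero is open and null, hence
  empty.\<close>

lemma AE_eq_0_imp_eq_0_on_open:
  fixes f :: "'a::euclidean_space \<Rightarrow> real"
  assumes S: "open S" and f: "continuous_on S f"
    and ae: "AE x in lborel. x \<in> S \<longrightarrow> f x = 0" and x: "x \<in> S"
  shows "f x = 0"
proof -
  let ?W = "S \<inter> f -` (- {0})"
  have W: "open ?W"
    using f S by (intro continuous_open_preimage) auto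
  have "AE x in lborel. x \<notin> ?W"
    using ae by eventually_elim auto
  then have "?W \<in> null_sets lborel"
    using W by (subst AE_iff_null_sets) auto
  then have "negligible ?W"
    using null_sets_completionI negligible_iff_null_sets by blast
  then show ?thesis
    using open_not_negligible[OF W] x by auto
qed

text \<open>Truncating at \<open>-1\<close> from below turns the one-sided bound into a two-sided one, so that
  dominated convergence applies.\<close>

lemma (in finite_measure) AE_limit_eq_0_of_integral_nonneg:
  fixes F :: "nat \<Rightarrow> 'a \<Rightarrow> real"
  assumes int: "\<And>n. integrable M (F n)" and nonneg: "\<And>n. 0 \<le> integral\<^sup>L M (F n)"
    and bound: "\<And>n x. x \<in> space M \<Longrightarrow> F n x \<le> C"
    and lim: "\<And>x. x \<in> space M \<Longrightarrow> (\<lambda>n. F n x) \<longlonglongrightarrow> f x"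
    and nonpos: "\<And>x. x \<in> space M \<Longrightarrow> f x \<le> 0"
  shows "AE x in M. f x = 0"
proof -
  have [measurable]: "F n \<in> borel_measurable M" for n
    using int[of n] by simp
  have [measurable]: "f \<in> borel_measurable M"
    by (rule borel_measurable_LIMSEQ_real[OF lim]) auto
  let ?P = "\<lambda>n x. max (F n x) (- 1)" and ?p = "\<lambda>x. max (f x) (- 1)"
  have dom: "AE x in M. norm (?P n x) \<le> max C 1" for n
    by (rule AE_I2) (use bound[of _ n] in fastforce)
  have conv: "AE x in M. (\<lambda>n. ?P n x) \<longlonglongrightarrow> ?p x"
    by (intro AE_I2 tendsto_max lim tendsto_const)
  have P: "integrable M (?P n)" for n
    by (rule integrable_const_bound[OF dom]) simp
  have p: "integrable M ?p"
    by (rule integrable_dominated_convergence[OF _ _ _ conv dom]) simp_all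
  have "(\<lambda>n. integral\<^sup>L M (?P n)) \<longlonglongrightarrow> integral\<^sup>L M ?p"
    by (rule integral_dominated_convergence[OF _ _ _ conv dom]) simp_all
  \<comment> \<open>Truncation from below only raises the integrals, so their sign survives.\<close>
  moreover have "0 \<le> integral\<^sup>L M (?P n)" for n
    using nonneg[of n] integral_mono[OF int P, of n n] by (meson max.cobounded1 order_trans)
  ultimately have "0 \<le> integral\<^sup>L M ?p"
    by (intro LIMSEQ_le_const) auto
  moreover have "0 \<le> integral\<^sup>L M (\<lambda>x. - ?p x)"
    using nonpos by (intro Bochner_Integration.integral_nonneg) auto
  ultimately have "integral\<^sup>L M (\<lambda>x. - ?p x) = 0"
    by simp
  then have "AE x in M. - ?p x = 0"
    by (subst (asm) integral_nonneg_eq_0_iff_AE) (use p nonpos in auto)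
  \<comment> \<open>A zero of \<open>max (f x) (- 1)\<close> is a zero of \<open>f\<close>, since
    the truncation level is not \<open>0\<close>.\<close>
  then show ?thesis
    by eventually_elim (auto simp: max_def split: if_splits)
qed

section \<open>Bounds on solutions and on the reaction term\<close>

lemma weak_solution_bounded:
  assumes "weak_solution s \<Omega> g u" "0 < s" "bounded \<Omega>" and pos: "\<And>x. x \<in> \<Omega> \<Longrightarrow> 0 < u x"
  obtains M where "\<And>x. 0 \<le> u x" "\<And>x. u x \<le> M"
proof -
  have zero: "\<And>x. x \<notin> \<Omega> \<Longrightarrow> u x = 0" and "continuous_on (closure \<Omega>) u"
    using assms by (auto simp: weak_solution_def Hs0_def intro: holder_on_imp_continuous_on)
  then have "compact (u ` closure \<Omega>)"
    using assms by (intro compact_continuous_image) auto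
  then obtain B where B: "\<And>x. x \<in> closure \<Omega> \<Longrightarrow> \<bar>u x\<bar> \<le> B"
    by (metis (no_types, lifting) bounded_iff compact_imp_bounded imageI real_norm_def)
  show ?thesis
  proof
    fix x
    show "0 \<le> u x" using pos[of x] zero[of x] by (cases "x \<in> \<Omega>") auto
    \<comment> \<open>The maximum with \<open>0\<close> covers the points outside
      \<open>\<Omega>\<close>, where \<open>u\<close> vanishes.\<close>
    show "u x \<le> max B 0"
      using B[of x] zero[of x] closure_subset[of \<Omega>] by (cases "x \<in> \<Omega>") auto
  qed
qed

lemma continuous_on_bounded_slab:
  fixes h :: "'a::euclidean_space \<Rightarrow> real \<Rightarrow> real"
  assumes "compact K" "continuous_on (K \<times> {0..}) (\<lambda>(x, t). h x t)"
  obtains B where "0 \<le> B" "\<And>x t. x \<in> K \<Longrightarrow> 0 \<le> t \<Longrightarrow> t \<le> M \<Longrightarrow> \<bar>h x t\<bar> \<le> B"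
proof -
  have "compact ((\<lambda>(x, t). h x t) ` (K \<times> {0..M}))"
    using assms
    by (intro compact_continuous_image compact_Times) (auto intro: continuous_on_subset)
  then obtain B where B: "\<And>z. z \<in> K \<times> {0..M} \<Longrightarrow> \<bar>case z of (x, t) \<Rightarrow> h x t\<bar> \<le> B"
    by (metis (no_types, lifting) bounded_iff compact_imp_bounded imageI real_norm_def)
  show ?thesis
    by (rule that[of "max B 0"]) (use B in fastforce)+
qed

text \<open>Away from \<open>t = 0\<close> boundedness of \<open>h\<close> suffices, so the Lipschitz condition is only needed
  at \<open>t = 0\<close>.\<close>

lemma lipschitz_at_0_imp_linear_bound:
  fixes h :: "'a::euclidean_space \<Rightarrow> real \<Rightarrow> real"
  assumes K: "compact K" and cont: "continuous_on (K \<times> {0..}) (\<lambda>(x, t). h x t)"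
    and zero: "\<And>x. x \<in> K \<Longrightarrow> h x 0 = 0"
    and lip: "\<exists>\<delta>>0. \<exists>L. \<forall>x\<in>K. L-lipschitz_on (cball 0 \<delta>) (h x)"
  obtains L where "0 \<le> L" "\<And>x t. x \<in> K \<Longrightarrow> 0 \<le> t \<Longrightarrow> t \<le> M \<Longrightarrow> \<bar>h x t\<bar> \<le> L * t"
proof -
  obtain B where B: "0 \<le> B" "\<And>x t. x \<in> K \<Longrightarrow> 0 \<le> t \<Longrightarrow> t \<le> M \<Longrightarrow> \<bar>h x t\<bar> \<le> B"
    using continuous_on_bounded_slab[OF K cont] by metis
  obtain \<delta> L where \<delta>: "0 < \<delta>" and L: "\<And>x. x \<in> K \<Longrightarrow> L-lipschitz_on (cball 0 \<delta>) (h x)"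
    using lip by blast
  \<comment> \<open>The second entry serves \<open>t > \<delta>\<close>, where
    \<open>B \<le> B / \<delta> * t\<close>.\<close>
  let ?L = "max L (B / \<delta>)"
  have "0 \<le> B / \<delta>"
    using \<delta> B by simp
  then have L0: "0 \<le> ?L"
    by (simp add: max.coboundedI2)
  have "\<bar>h x t\<bar> \<le> ?L * t" if x: "x \<in> K" and t: "0 \<le> t" "t \<le> M" for x t
  proof (cases "t \<le> \<delta>")
    case True
    then have "\<bar>h x t - h x 0\<bar> \<le> L * \<bar>t - 0\<bar>"
      using lipschitz_onD[OF L[OF x], of t 0] t \<delta> by (simp add: dist_real_def)
    also have "\<dots> \<le> ?L * t"
      using t by (simp add: mult_right_mono)
    finally show ?thesis
      using zero[OF x] by simp
  next
    case False
    have "B = B / \<delta> * \<delta>" using \<delta> by simp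
    also have "\<dots> \<le> ?L * t"
      using False \<delta> L0 by (intro mult_mono) auto
    finally show ?thesis
      using B(2)[OF x t] by simp
  qed
  then show ?thesis
    using that L0 by blast
qed

text \<open>The nonnegative part \<open>b\<close> of the reaction only meets the harmless upper bound
  \<open>U - V\<^sup>2 / U \<le> U\<close>, while the factor \<open>1 / U\<close> is absorbed by the linear bound on \<open>a\<close>.\<close>

lemma picone_reaction_bound:
  fixes a b t r \<epsilon> :: real
  assumes e: "0 < \<epsilon>" "\<epsilon> \<le> 1" and t: "0 \<le> t" "t \<le> M" and r: "0 \<le> r" "r \<le> M"
    and a: "\<bar>a\<bar> \<le> L * t" and L: "0 \<le> L" and b: "0 \<le> b" "b \<le> B"
  shows "(a + b) * ((t + \<epsilon>) - (r + \<epsilon>)\<^sup>2 / (t + \<epsilon>)) \<le> L * (M + 1)\<^sup>2 + B * (M + 1)"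
proof -
  define U V where "U = t + \<epsilon>" and "V = r + \<epsilon>"
  \<comment> \<open>Here \<open>\<epsilon> \<le> 1\<close> makes the bounds independent of
    \<open>\<epsilon>\<close>.\<close>
  have U: "0 < U" "U \<le> M + 1" and V: "0 < V" "V \<le> M + 1"
    using assms by (auto simp: U_def V_def)
  have "\<bar>a\<bar> \<le> L * U"
    using a L e mult_left_mono[of t U L] by (auto simp: U_def)
  then have a': "\<bar>a\<bar> / U \<le> L"
    using U by (simp add: pos_divide_le_eq)
  have "U\<^sup>2 \<le> (M + 1)\<^sup>2" "V\<^sup>2 \<le> (M + 1)\<^sup>2"
    using U V by (simp_all add: power_mono)
  \<comment> \<open>Both squares lie between \<open>0\<close> and \<open>(M + 1)\<^sup>2\<close>,
    and so does the distance between them.\<close>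
  then have UV: "\<bar>U\<^sup>2 - V\<^sup>2\<bar> \<le> (M + 1)\<^sup>2"
    using zero_le_power2[of U] zero_le_power2[of V] by linarith
  have quot: "U - V\<^sup>2 / U = (U\<^sup>2 - V\<^sup>2) / U"
    using U by (simp add: diff_divide_distrib power2_eq_square)
  have "a * (U - V\<^sup>2 / U) \<le> \<bar>a * (U - V\<^sup>2 / U)\<bar>"
    by simp
  also have "\<dots> = \<bar>a\<bar> / U * \<bar>U\<^sup>2 - V\<^sup>2\<bar>"
    using U by (simp add: quot abs_mult)
  also have "\<dots> \<le> L * (M + 1)\<^sup>2"
    using a' UV L by (intro mult_mono) auto
  finally have 1: "a * (U - V\<^sup>2 / U) \<le> L * (M + 1)\<^sup>2" .
  have "b * (U - V\<^sup>2 / U) \<le> b * U"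
    using b U by (intro mult_left_mono) auto
  also have "\<dots> \<le> B * (M + 1)"
    using b U by (intro mult_mono) auto
  finally show ?thesis
    using 1 by (simp add: U_def V_def distrib_right)
qed

text \<open>Identifies the integrand at \<open>\<epsilon> = 0\<close>: the first product is
  \<open>a / t * (t\<^sup>2 - r\<^sup>2)\<close>, and exchanging the roles reverses the sign of the
  difference of squares.\<close>

lemma picone_limit_factor:
  fixes t r a b :: real
  assumes "0 < t" "0 < r"
  shows "a * (t - r\<^sup>2 / t) + b * (r - t\<^sup>2 / r) = (a / t - b / r) * (t\<^sup>2 - r\<^sup>2)"
proof -
  define p q where "p = a / t" and "q = b / r"
  have a: "a = p * t" and b: "b = q * r"
    using assms by (auto simp: p_def q_def)
  have "a * (t - r\<^sup>2 / t) = p * (t\<^sup>2 - r\<^sup>2)" "b * (r - t\<^sup>2 / r) = q * (r\<^sup>2 - t\<^sup>2)"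
    using assms by (simp_all add: a b right_diff_distrib power2_eq_square mult.assoc)
  then show ?thesis
    unfolding p_def[symmetric] q_def[symmetric] by (simp add: algebra_simps)
qed

lemma quotient_strict_antimono_sign:
  fixes h :: "real \<Rightarrow> real"
  assumes anti: "\<And>t1 t2. 0 < t1 \<Longrightarrow> t1 < t2 \<Longrightarrow> h t2 / t2 < h t1 / t1"
    and t: "0 < t" "0 < r" "t \<noteq> r"
  shows "(h t / t - h r / r) * (t\<^sup>2 - r\<^sup>2) < 0"
proof (cases "t < r")
  case True
  then have "t\<^sup>2 < r\<^sup>2" using t by (intro power_strict_mono) auto
  then show ?thesis using anti[OF t(1) True] by (intro mult_pos_neg) auto
next
  case False
  then have "r < t" using t by simp
  then have "r\<^sup>2 < t\<^sup>2" using t by (intro power_strict_mono) auto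
  then show ?thesis using anti[OF t(2) \<open>r < t\<close>] by (intro mult_neg_pos) auto
qed

section \<open>Uniqueness of positive weak solutions\<close>

theorem theorem6p1:
  fixes \<Omega> :: "(real^'n) set" and s :: real
    and g g1 g2 :: "real^'n \<Rightarrow> real \<Rightarrow> real"
    and X :: "(real^'n \<Rightarrow> real) set" and nX :: "(real^'n \<Rightarrow> real) \<Rightarrow> real"
  assumes domain: "bounded_smooth_domain \<Omega>"
    and s: "0 < s" "s < 1"
    and G: "\<And>x. x \<in> \<Omega> \<Longrightarrow> strictly_concave_on {0..} (\<lambda>t. primitive g x (sqrt t))"
    and g_cont: "continuous_on (closure \<Omega> \<times> UNIV) (\<lambda>(x, t). g x t)"
    and g_split: "\<And>x t. x \<in> closure \<Omega> \<Longrightarrow> g x t = g1 x t + g2 x t"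
    and g1_zero: "\<And>x. x \<in> closure \<Omega> \<Longrightarrow> g1 x 0 = 0"
    and g1_lipschitz: "\<And>t0. \<exists>\<delta>>0. \<exists>L. \<forall>x\<in>closure \<Omega>. L-lipschitz_on (cball t0 \<delta>) (g1 x)"
    and g2_cont: "continuous_on (closure \<Omega> \<times> {0..}) (\<lambda>(x, t). g2 x t)"
    and g2_nonneg: "\<And>x t. x \<in> closure \<Omega> \<Longrightarrow> 0 \<le> t \<Longrightarrow> 0 \<le> g2 x t"
    and X: "(X = Hs0 s \<Omega> \<and> nX = norm_Hs s) \<or>
            (\<exists>p>2. X = Hs0 s \<Omega> \<inter> Lp p \<Omega> \<and> nX = (\<lambda>u. norm_Hs s u + norm_Lp p \<Omega> u))"
    and G_integrable: "\<And>u. u \<in> X \<Longrightarrow> set_integrable lborel \<Omega> (\<lambda>x. primitive g x (u x))"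
    and g_integrable: "\<And>u v. u \<in> X \<Longrightarrow> v \<in> X \<Longrightarrow>
           set_integrable lborel \<Omega> (\<lambda>x. g x (u x) * v x)"
    and energy_differentiable: "\<And>u. u \<in> X \<Longrightarrow>
           \<exists>L. has_frechet_derivative_in (energy s \<Omega> g) L X nX u"
    and potential_derivative: "\<And>u. u \<in> X \<Longrightarrow>
           has_frechet_derivative_in (potential \<Omega> g)
             (\<lambda>v. LINT x:\<Omega>|lborel. g x (u x) * v x) X nX u"
  shows "\<exists>\<^sub>\<le>\<^sub>1 u. weak_solution s \<Omega> g u \<and> (\<forall>x\<in>\<Omega>. 0 < u x)"
proof (rule Uniq_I)
  fix u v
  assume "weak_solution s \<Omega> g u \<and> (\<forall>x\<in>\<Omega>. 0 < u x)" "weak_solution s \<Omega> g v \<and> (\<forall>x\<in>\<Omega>. 0 < v x)"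
  then have wu: "weak_solution s \<Omega> g u" and wv: "weak_solution s \<Omega> g v"
    and upos: "\<And>x. x \<in> \<Omega> \<Longrightarrow> 0 < u x" and vpos: "\<And>x. x \<in> \<Omega> \<Longrightarrow> 0 < v x"
    by auto
  have \<Omega>: "open \<Omega>" "bounded \<Omega>"
    using domain by (auto simp: bounded_smooth_domain_def)
  define K where "K = closure \<Omega>"
  have K: "compact K" and \<Omega>K: "\<Omega> \<subseteq> K"
    using \<Omega> by (auto simp: K_def closure_subset)
  have uH: "u \<in> Hs0 s \<Omega>" and vH: "v \<in> Hs0 s \<Omega>"
    and ucont: "continuous_on K u" and vcont: "continuous_on K v"
    using wu wv s by (auto simp: weak_solution_def K_def intro: holder_on_imp_continuous_on)
  obtain Mu where Mu: "\<And>x. 0 \<le> u x" "\<And>x. u x \<le> Mu"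
    using weak_solution_bounded[OF wu s(1) \<Omega>(2) upos] by metis
  obtain Mv where Mv: "\<And>x. 0 \<le> v x" "\<And>x. v x \<le> Mv"
    using weak_solution_bounded[OF wv s(1) \<Omega>(2) vpos] by metis
  define M where "M = max Mu Mv"
  have uM: "0 \<le> u x \<and> u x \<le> M" and vM: "0 \<le> v x \<and> v x \<le> M" for x
    using Mu[of x] Mv[of x] by (auto simp: M_def)

  \<comment> \<open>Joint continuity of \<open>g1\<close> is not among the hypotheses; it is
    recovered from \<open>g1 = g - g2\<close>.\<close>
  have g1_cont: "continuous_on (K \<times> {0..}) (\<lambda>(x, t). g1 x t)"
  proof -
    have "continuous_on (K \<times> {0..}) (\<lambda>z. (case z of (x, t) \<Rightarrow> g x t) - (case z of (x, t) \<Rightarrow> g2 x t))"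
      using g_cont g2_cont unfolding K_def
      by (intro continuous_on_diff) (auto intro: continuous_on_subset)
    then show ?thesis
      by (rule continuous_on_eq) (auto simp: g_split K_def)
  qed
  obtain L where L: "0 \<le> L" "\<And>x t. x \<in> K \<Longrightarrow> 0 \<le> t \<Longrightarrow> t \<le> M \<Longrightarrow> \<bar>g1 x t\<bar> \<le> L * t"
    by (rule lipschitz_at_0_imp_linear_bound[OF K g1_cont, of M])
      (use g1_zero g1_lipschitz[of 0] in \<open>auto simp: K_def\<close>)
  obtain B where B: "0 \<le> B" "\<And>x t. x \<in> K \<Longrightarrow> 0 \<le> t \<Longrightarrow> t \<le> M \<Longrightarrow> \<bar>g2 x t\<bar> \<le> B"
    by (rule continuous_on_bounded_slab[OF K, of g2 M]) (use g2_cont in \<open>auto simp: K_def\<close>)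

  define F where "F \<epsilon> x = g x (u x) * picone_test \<epsilon> u v x + g x (v x) * picone_test \<epsilon> v u x" for \<epsilon> x
  have g_comp: "continuous_on K (\<lambda>x. g x (w x))" if "continuous_on K w" for w
  proof -
    have "continuous_on K (\<lambda>x. (x, w x))"
      using that by (intro continuous_intros)
    then show ?thesis
      using continuous_on_compose2[OF g_cont, of K "\<lambda>x. (x, w x)"] by (auto simp: K_def)
  qed
  \<comment> \<open>The denominator \<open>w x + \<epsilon>\<close> never vanishes, so the integrand
    is continuous on the compact set \<open>K\<close>.\<close>
  have int: "set_integrable lborel \<Omega> (\<lambda>x. g x (w x) * picone_test \<epsilon> w w' x)"
    if "0 < \<epsilon>" "continuous_on K w" "continuous_on K w'" "\<And>x. 0 \<le> w x" for \<epsilon> w w'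
  proof (rule set_integrable_subset)
    have "w x + \<epsilon> \<noteq> 0" for x
      using that(1) that(4)[of x] by linarith
    then show "set_integrable lborel K (\<lambda>x. g x (w x) * picone_test \<epsilon> w w' x)"
      unfolding set_integrable_def picone_test_def
      using that by (intro borel_integrable_compact K continuous_intros g_comp) auto
  qed (use \<Omega> \<Omega>K in auto)
  have F_int: "set_integrable lborel \<Omega> (F \<epsilon>)" if "0 < \<epsilon>" for \<epsilon>
    unfolding F_def using that ucont vcont uM vM by (intro set_integral_add int) auto
  \<comment> \<open>The two weak formulations turn this integral into half the sum of the Gagliardo
    forms.\<close>
  have F_nonneg: "0 \<le> (LINT x:\<Omega>|lborel. F \<epsilon> x)" if e: "0 < \<epsilon>" for \<epsilon>
  proof -
    have "(LINT x:\<Omega>|lborel. F \<epsilon> x) = 1 / 2 * gagliardo_form s u (picone_test \<epsilon> u v)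
        + 1 / 2 * gagliardo_form s v (picone_test \<epsilon> v u)"
      unfolding F_def using wu wv
        picone_test_in_Hs0[OF uH vH \<Omega>(2) e uM vM] picone_test_in_Hs0[OF vH uH \<Omega>(2) e vM uM]
        int[OF e ucont vcont] int[OF e vcont ucont] uM vM
      by (simp add: weak_solution_def set_integral_add(2))
    then show ?thesis
      using gagliardo_form_picone_nonneg[OF uH vH \<Omega>(2) e uM vM] by simp
  qed
  \<comment> \<open>One reaction bound for each of the two terms of \<open>F\<close>; the constant
    does not depend on \<open>\<epsilon>\<close>.\<close>
  let ?C = "2 * (L * (M + 1)\<^sup>2 + B * (M + 1))"
  have F_le: "F \<epsilon> x \<le> ?C" if e: "0 < \<epsilon>" "\<epsilon> \<le> 1" and x: "x \<in> \<Omega>" for \<epsilon> x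
  proof -
    have "x \<in> K" and gx: "\<And>t. g x t = g1 x t + g2 x t" and g2x: "\<And>t. 0 \<le> t \<Longrightarrow> 0 \<le> g2 x t"
      using x \<Omega>K g_split g2_nonneg by (auto simp: K_def)
    have "g x (w x) * picone_test \<epsilon> w w' x \<le> L * (M + 1)\<^sup>2 + B * (M + 1)"
      if "\<And>x. 0 \<le> w x \<and> w x \<le> M" "\<And>x. 0 \<le> w' x \<and> w' x \<le> M" for w w'
      unfolding gx picone_test_def
      using that L B(2)[OF \<open>x \<in> K\<close>, of "w x"] \<open>x \<in> K\<close> g2x[of "w x"]
      by (intro picone_reaction_bound e) auto
    from this[of u v] this[of v u] uM vM show ?thesis
      by (simp add: F_def)
  qed

  define f where "f x = (g x (u x) / u x - g x (v x) / v x) * ((u x)\<^sup>2 - (v x)\<^sup>2)" for x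
  have f_neg: "f x < 0" if x: "x \<in> \<Omega>" and "u x \<noteq> v x" for x
    unfolding f_def
  proof (rule quotient_strict_antimono_sign[OF quotient_strict_antimono[OF G[OF x]]])
    show "continuous_on UNIV (g x)"
      using x closure_subset[of \<Omega>]
      by (intro continuous_on_compose2[OF g_cont, of UNIV "\<lambda>t. (x, t)", simplified]
          continuous_intros) auto
  qed (use that upos vpos in auto)
  have f_zero: "f x = 0" if "u x = v x" for x
    using that by (simp add: f_def)
  \<comment> \<open>Using \<open>Suc n\<close> keeps every \<open>?e n\<close> positive and at most
    \<open>1\<close>, the range in which \<open>F_le\<close> holds.\<close>
  let ?e = "\<lambda>n. 1 / real (Suc n)"
  have F_lim: "(\<lambda>n. F (?e n) x) \<longlonglongrightarrow> f x" if x: "x \<in> \<Omega>" for x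
  proof -
    have e: "?e \<longlonglongrightarrow> 0"
      using LIMSEQ_inverse_real_of_nat by (simp add: inverse_eq_divide)
    have "(\<lambda>n. F (?e n) x) \<longlonglongrightarrow> g x (u x) * ((u x + 0) - (v x + 0)\<^sup>2 / (u x + 0))
        + g x (v x) * ((v x + 0) - (u x + 0)\<^sup>2 / (v x + 0))"
      unfolding F_def picone_test_def
      \<comment> \<open>Positivity inside \<open>\<Omega>\<close> keeps the limiting denominators
        nonzero; no uniformity up to the boundary is required.\<close>
      using upos[OF x] vpos[OF x] by (intro tendsto_intros e) auto
    then show ?thesis
      using picone_limit_factor[OF upos[OF x] vpos[OF x]] by (simp add: f_def)
  qed

  let ?N = "restrict_space lborel \<Omega>"
  interpret finite_measure ?N
    using \<Omega> emeasure_bounded_finite[OF \<Omega>(2)]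
    by (intro finite_measureI) (auto simp: emeasure_restrict_space space_restrict_space)
  have "AE x in ?N. f x = 0"
  proof (rule AE_limit_eq_0_of_integral_nonneg[where F = "\<lambda>n. F (?e n)"])
    show "integrable ?N (F (?e n))" "0 \<le> integral\<^sup>L ?N (F (?e n))" for n
      using F_int[of "?e n"] F_nonneg[of "?e n"] \<Omega>
      by (simp_all add: integrable_restrict_space integral_restrict_space
          set_integrable_def set_lebesgue_integral_def)
    show "F (?e n) x \<le> ?C" if "x \<in> space ?N" for n x
      using that by (intro F_le) (auto simp: space_restrict_space)
    show "f x \<le> 0" if "x \<in> space ?N" for x
      using that f_neg[of x] f_zero[of x] by (cases "u x = v x") (auto simp: space_restrict_space)
  qed (use F_lim in \<open>simp add: space_restrict_space\<close>)
  then have "AE x in lborel. x \<in> \<Omega> \<longrightarrow> f x = 0"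
    using \<Omega> by (simp add: AE_restrict_space_iff)
  \<comment> \<open>At a point of \<open>\<Omega>\<close> with \<open>u x \<noteq> v x\<close> the
    limit \<open>f x\<close> would be negative.\<close>
  then have ae: "AE x in lborel. x \<in> \<Omega> \<longrightarrow> u x - v x = 0"
    by eventually_elim (use f_neg in force)
  \<comment> \<open>Continuity removes the exceptional null set, as equality of functions and not of
    classes is claimed.\<close>
  have eq: "u x - v x = 0" if "x \<in> \<Omega>" for x
    by (rule AE_eq_0_imp_eq_0_on_open[OF \<Omega>(1) _ ae that])
      (intro continuous_on_diff continuous_on_subset[OF ucont \<Omega>K] continuous_on_subset[OF vcont \<Omega>K])
  show "u = v"
  proof
    show "u x = v x" for x
      using eq[of x] uH vH by (cases "x \<in> \<Omega>") (simp_all add: Hs0_def)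
  qed
qed

end
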